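(* Let $f\colon P\to Q$ and $g\colon Q'\to Q$ be surjective quandle homomorphisms, let $P'=P\times_Q Q'$ be their pullback, and let $g'\colon P'\to P$ and $f'\colon P'\to Q'$ be the projections. Then there exists an exact sequence of groups $$1\longrightarrow\mathrm{Inn}_{\mathrm{rel}}(f')\xrightarrow{\ g'_*\ }\mathrm{Inn}_{\mathrm{rel}}(f)\xrightarrow{\ \delta_{f,g}\ }\frac{\mathrm{Inn}_{\mathrm{rel}}(g)}{f'_*(\mathrm{Inn}_{\mathrm{rel}}(g'))}\longrightarrow 1.$$
   Context: A quandle is a set $Q$ with bijections $s_x\colon Q\to Q$ ($x\in Q$) such that $s_x(x)=x$ and $s_x\circ s_y=s_{s_x(y)}\circ s_x$ for all $x,y\in Q$. A quandle homomorphism $f\colon P\to Q$ is a map with $f(s_x(y))=s_{f(x)}(f(y))$ for all $x,y\in P$. The inner automorphism group $\mathrm{Inn}(P)$ is the group of permutations of $P$ generated by all $s_x$, $x\in P$. A surjective quandle homomorphism $f\colon P\to Q$ induces a surjective group homomorphism $f_*\colon\mathrm{Inn}(P)\to\mathrm{Inn}(Q)$, where $f_*(\varphi)$ is the unique element of $\mathrm{Inn}(Q)$ with $f\circ\varphi=f_*(\varphi)\circ f$. Put $\mathrm{Inn}_{\mathrm{rel}}(f)=\ker(f_* )$. The pullback $P\times_Q Q'=\{(x,q')\in P\times Q'\mid f(x)=g(q')\}$ carries the componentwise quandle structure. The homomorphism $\delta_{f,g}$ is the connecting map sending $\varphi\in\mathrm{Inn}_{\mathrm{rel}}(f)$ to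 the class of $f'_*(\tilde\varphi)$, where $\tilde\varphi\in\mathrm{Inn}(P')$ is any element with $g'_*(\tilde\varphi)=\varphi$. *)

theory Defs
  imports "HOL-Algebra.Bij" "HOL-Algebra.Coset" "HOL-Algebra.Generated_Groups"
begin

record 'a quandle_struct = "'a partial_object" +
  qsym :: "'a \<Rightarrow> 'a \<Rightarrow> 'a"

locale quandle =
  fixes Q :: "('a, 'b) quandle_struct_scheme" (structure)
  assumes qsym_bij: "x \<in> carrier Q \<Longrightarrow> bij_betw (qsym Q x) (carrier Q) (carrier Q)"
    and qsym_self: "x \<in> carrier Q \<Longrightarrow> qsym Q x x = x"
    and qsym_conj: "\<lbrakk>x \<in> carrier Q; y \<in> carrier Q; z \<in> carrier Q\<rbrakk> \<Longrightarrow>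
      qsym Q x (qsym Q y z) = qsym Q (qsym Q x y) (qsym Q x z)"

definition quandle_hom ::
    "('a, 'm) quandle_struct_scheme \<Rightarrow> ('b, 'n) quandle_struct_scheme \<Rightarrow> ('a \<Rightarrow> 'b) set"
  where "quandle_hom P Q = {f \<in> carrier P \<rightarrow> carrier Q.
    \<forall>x\<in>carrier P. \<forall>y\<in>carrier P. f (qsym P x y) = qsym Q (f x) (f y)}"

definition quandle_epi ::
    "('a, 'm) quandle_struct_scheme \<Rightarrow> ('b, 'n) quandle_struct_scheme \<Rightarrow> ('a \<Rightarrow> 'b) set"
  where "quandle_epi P Q = {f \<in> quandle_hom P Q. f ` carrier P = carrier Q}"

text \<open>The elements of \<^const>\<open>BijGroup\<close> are extensional functions, so the maps
  \<^const>\<open>qsym\<close> have to be restricted to the carrier.\<close>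

definition Inn :: "('a, 'm) quandle_struct_scheme \<Rightarrow> ('a \<Rightarrow> 'a) monoid"
  where "Inn Q = subgroup_generated (BijGroup (carrier Q))
    ((\<lambda>x. restrict (qsym Q x) (carrier Q)) ` carrier Q)"

definition Inn_map ::
    "('a, 'm) quandle_struct_scheme \<Rightarrow> ('b, 'n) quandle_struct_scheme \<Rightarrow> ('a \<Rightarrow> 'b)
      \<Rightarrow> ('a \<Rightarrow> 'a) \<Rightarrow> ('b \<Rightarrow> 'b)"
  where "Inn_map P Q f \<phi> =
    (THE \<psi>. \<psi> \<in> carrier (Inn Q) \<and> (\<forall>x\<in>carrier P. f (\<phi> x) = \<psi> (f x)))"

definition Inn_rel ::
    "('a, 'm) quandle_struct_scheme \<Rightarrow> ('b, 'n) quandle_struct_scheme \<Rightarrow> ('a \<Rightarrow> 'b)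
      \<Rightarrow> ('a \<Rightarrow> 'a) monoid"
  where "Inn_rel P Q f = (Inn P)\<lparr>carrier := kernel (Inn P) (Inn Q) (Inn_map P Q f)\<rparr>"

definition quandle_pullback ::
    "('a, 'm) quandle_struct_scheme \<Rightarrow> ('c, 'n) quandle_struct_scheme
      \<Rightarrow> ('a \<Rightarrow> 'b) \<Rightarrow> ('c \<Rightarrow> 'b) \<Rightarrow> ('a \<times> 'c) quandle_struct"
  where "quandle_pullback P Q' f g =
    \<lparr>carrier = {(x, q'). x \<in> carrier P \<and> q' \<in> carrier Q' \<and> f x = g q'},
     qsym = (\<lambda>(x, q') (y, r'). (qsym P x y, qsym Q' q' r'))\<rparr>"

text \<open>The projections of the pullback are \<^const>\<open>fst\<close> (written \<open>g'\<close> in the mathematics) and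
  \<^const>\<open>snd\<close> (written \<open>f'\<close>).\<close>

definition Inn_rel_image ::
    "('a, 'm) quandle_struct_scheme \<Rightarrow> ('c, 'n) quandle_struct_scheme
      \<Rightarrow> ('a \<Rightarrow> 'b) \<Rightarrow> ('c \<Rightarrow> 'b) \<Rightarrow> ('c \<Rightarrow> 'c) set"
  where "Inn_rel_image P Q' f g =
    (let P' = quandle_pullback P Q' f g
     in Inn_map P' Q' snd ` carrier (Inn_rel P' P fst))"

text \<open>Any lift of \<open>\<phi>\<close> along \<open>g'\<^sub>*\<close> may be used to define the connecting map; one is chosen
  here, so existence of lifts and independence of the choice are not part of the definition.\<close>

definition connecting_map ::
    "('a, 'm) quandle_struct_scheme \<Rightarrow> ('b, 'o) quandle_struct_scheme
      \<Rightarrow> ('c, 'n) quandle_struct_scheme \<Rightarrow> ('a \<Rightarrow> 'b) \<Rightarrow> ('c \<Rightarrow> 'b)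
      \<Rightarrow> ('a \<Rightarrow> 'a) \<Rightarrow> ('c \<Rightarrow> 'c) set"
  where "connecting_map P Q Q' f g \<phi> =
    (let P' = quandle_pullback P Q' f g;
         \<phi>' = (SOME \<phi>'. \<phi>' \<in> carrier (Inn P') \<and> Inn_map P' P fst \<phi>' = \<phi>)
     in Inn_rel_image P Q' f g #>\<^bsub>Inn_rel Q' Q g\<^esub> Inn_map P' Q' snd \<phi>')"

text \<open>Exactness of \<open>1 \<longrightarrow> A \<longrightarrow> B \<longrightarrow> C \<longrightarrow> 1\<close>. The notion in
  HOL-Algebra (\<open>exact_seq\<close>) requires all groups to have elements of the same type.\<close>

definition short_exact ::
    "('a, 'm) monoid_scheme \<Rightarrow> ('b, 'n) monoid_scheme \<Rightarrow> ('c, 'o) monoid_scheme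
      \<Rightarrow> ('a \<Rightarrow> 'b) \<Rightarrow> ('b \<Rightarrow> 'c) \<Rightarrow> bool"
  where "short_exact A B C i p \<longleftrightarrow>
    group_hom A B i \<and> group_hom B C p \<and>
    kernel A B i = {\<one>\<^bsub>A\<^esub>} \<and> i ` carrier A = kernel B C p \<and> p ` carrier B = carrier C"

lemma quandle_pullback:
  assumes "quandle P" "quandle Q" "quandle Q'" "f \<in> quandle_hom P Q" "g \<in> quandle_hom Q' Q"
  shows "quandle (quandle_pullback P Q' f g)"
proof -
  interpret P: quandle P by fact
  interpret Q: quandle Q by fact
  interpret Q': quandle Q' by fact
  have f: "f x \<in> carrier Q" "y \<in> carrier P \<Longrightarrow> f (qsym P x y) = qsym Q (f x) (f y)"
    if "x \<in> carrier P" for x y using assms(4) that by (auto simp: quandle_hom_def)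
  have g: "g x \<in> carrier Q" "y \<in> carrier Q' \<Longrightarrow> g (qsym Q' x y) = qsym Q (g x) (g y)"
    if "x \<in> carrier Q'" for x y using assms(5) that by (auto simp: quandle_hom_def)
  have P_cl: "qsym P x y \<in> carrier P" if "x \<in> carrier P" "y \<in> carrier P" for x y
    using P.qsym_bij that by (meson bij_betwE)
  have Q'_cl: "qsym Q' x y \<in> carrier Q'" if "x \<in> carrier Q'" "y \<in> carrier Q'" for x y
    using Q'.qsym_bij that by (meson bij_betwE)
  show ?thesis
  proof
    fix u assume u: "u \<in> carrier (quandle_pullback P Q' f g)"
    then obtain x q where uxq: "u = (x, q)" and x: "x \<in> carrier P" and q: "q \<in> carrier Q'"
      and xq: "f x = g q" by (auto simp: quandle_pullback_def)
    have px: "bij_betw (qsym P x) (carrier P) (carrier P)" using P.qsym_bij x .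
    have qq: "bij_betw (qsym Q' q) (carrier Q') (carrier Q')" using Q'.qsym_bij q .
    have qx: "inj_on (qsym Q (f x)) (carrier Q)" using Q.qsym_bij f x by (meson bij_betw_def)
    show "bij_betw (qsym (quandle_pullback P Q' f g) u)
        (carrier (quandle_pullback P Q' f g)) (carrier (quandle_pullback P Q' f g))"
      unfolding bij_betw_def
    proof (intro conjI equalityI subsetI)
      show "inj_on (qsym (quandle_pullback P Q' f g) u) (carrier (quandle_pullback P Q' f g))"
        using px qq by (auto simp: quandle_pullback_def uxq inj_on_def bij_betw_def)
    next
      fix v assume "v \<in> qsym (quandle_pullback P Q' f g) u ` carrier (quandle_pullback P Q' f g)"
      then show "v \<in> carrier (quandle_pullback P Q' f g)"
        using x q xq f g P_cl Q'_cl by (auto simp: quandle_pullback_def uxq)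
    next
      fix v assume v: "v \<in> carrier (quandle_pullback P Q' f g)"
      then obtain y r where vyr: "v = (y, r)" and y: "y \<in> carrier P" and r: "r \<in> carrier Q'"
        and yr: "f y = g r" by (auto simp: quandle_pullback_def)
      obtain a where a: "a \<in> carrier P" "qsym P x a = y" using px y by (metis bij_betw_def imageE)
      obtain b where b: "b \<in> carrier Q'" "qsym Q' q b = r" using qq r by (metis bij_betw_def imageE)
      have "qsym Q (f x) (f a) = qsym Q (f x) (g b)"
        using yr f(2)[OF x a(1)] g(2)[OF q b(1)] a b xq by simp
      then have "f a = g b" using qx f(1) g(1) a b by (meson inj_onD)
      then have "(a, b) \<in> carrier (quandle_pullback P Q' f g)"
        using a b by (simp add: quandle_pullback_def)
      moreover have "qsym (quandle_pullback P Q' f g) u (a, b) = v"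
        using a b by (simp add: quandle_pullback_def uxq vyr)
      ultimately show "v \<in> qsym (quandle_pullback P Q' f g) u ` carrier (quandle_pullback P Q' f g)"
        by (metis imageI)
    qed
    show "qsym (quandle_pullback P Q' f g) u u = u"
      using x q P.qsym_self Q'.qsym_self by (simp add: quandle_pullback_def uxq)
  next
    fix u v w
    assume "u \<in> carrier (quandle_pullback P Q' f g)" "v \<in> carrier (quandle_pullback P Q' f g)"
      "w \<in> carrier (quandle_pullback P Q' f g)"
    then show "qsym (quandle_pullback P Q' f g) u (qsym (quandle_pullback P Q' f g) v w) =
        qsym (quandle_pullback P Q' f g) (qsym (quandle_pullback P Q' f g) u v)
          (qsym (quandle_pullback P Q' f g) u w)"
      using P.qsym_conj Q'.qsym_conj by (auto simp: quandle_pullback_def)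
  qed
qed

lemma quandle_pullback_projections:
  assumes "f \<in> quandle_epi P Q" "g \<in> quandle_epi Q' Q"
  shows "fst \<in> quandle_epi (quandle_pullback P Q' f g) P"
    and "snd \<in> quandle_epi (quandle_pullback P Q' f g) Q'"
proof -
  have "\<exists>q\<in>carrier Q'. f x = g q" if "x \<in> carrier P" for x
    using assms that unfolding quandle_epi_def by (smt (verit) imageE imageI mem_Collect_eq)
  then show "fst \<in> quandle_epi (quandle_pullback P Q' f g) P"
    by (force simp: quandle_epi_def quandle_hom_def quandle_pullback_def image_iff)
  have "\<exists>x\<in>carrier P. f x = g q" if "q \<in> carrier Q'" for q
    using assms that unfolding quandle_epi_def by (smt (verit) imageE imageI mem_Collect_eq)
  then show "snd \<in> quandle_epi (quandle_pullback P Q' f g) Q'"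
    by (force simp: quandle_epi_def quandle_hom_def quandle_pullback_def image_iff)
qed

end

(* Passing from a surjection of quandles to inner automorphism groups is functorial, so the
   pullback square induces a commutative square of surjections p: G \<rightarrow> A, q: G \<rightarrow> B, a: A \<rightarrow> C,
   b: B \<rightarrow> C of groups. An inner automorphism of the pullback is determined by its two
   coordinates, so ker p and ker q intersect trivially. Exactness is then a diagram chase that
   only uses these two facts. *)

theory Submission
  imports Defs
begin

section \<open>Diagram chase in a commutative square of groups\<close>

text \<open>In the application \<open>G\<close>, \<open>A\<close>, \<open>B\<close>,
  \<open>C\<close> are the inner automorphism groups of the pullback, \<open>P\<close>,
  \<open>Q'\<close> and \<open>Q\<close>, and all four maps are of the form
  \<open>Inn_map\<close>.\<close>

locale surjective_square =
  p: group_hom G A p + q: group_hom G B q + a: group_hom A C a + b: group_hom B C b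
  for G (structure) and A and B and C and p and q and a and b +
  assumes p_surj: "p ` carrier G = carrier A"
    and q_surj: "q ` carrier G = carrier B"
    and comm: "x \<in> carrier G \<Longrightarrow> a (p x) = b (q x)"
begin

text \<open>The kernels are written as record updates to match the definition of
  \<open>Inn_rel\<close>, so that unfolding it is enough to transfer results from the
  square.\<close>

abbreviation "K \<equiv> G\<lparr>carrier := kernel G B q\<rparr>"
abbreviation "A' \<equiv> A\<lparr>carrier := kernel A C a\<rparr>"
abbreviation "B' \<equiv> B\<lparr>carrier := kernel B C b\<rparr>"
abbreviation "N \<equiv> q ` kernel G A p"

lemma lift: "y \<in> kernel A C a \<Longrightarrow> \<exists>x\<in>carrier G. p x = y"
  by (auto simp: kernel_def simp flip: p_surj)

text \<open>Both sides say that the diagonal map from \<open>G\<close> to \<open>C\<close> sends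
  \<open>x\<close> to the unit.\<close>

lemma lift_kernel_iff: "x \<in> carrier G \<Longrightarrow> q x \<in> kernel B C b \<longleftrightarrow> p x \<in> kernel A C a"
  using comm by (simp add: kernel_def)

text \<open>A surjection carries the normal subgroup ker \<open>p\<close> to a normal subgroup of
  \<open>B\<close>, and commutativity puts this image inside ker \<open>b\<close>.\<close>

lemma normal_N: "N \<lhd> B'"
proof -
  have "N \<lhd> B"
    by (rule normal.surj_hom_normal_subgroup[OF p.normal_kernel q.group_hom_axioms q_surj])
  moreover have "N \<subseteq> kernel B C b"
    using lift_kernel_iff by (force simp: kernel_def)
  ultimately show ?thesis
    by (rule q.H.normal_restrict_supergroup[OF b.subgroup_kernel])
qed

text \<open>Two lifts of the same element differ by an element of ker \<open>p\<close>, whose image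
  under \<open>q\<close> lies in \<open>N\<close>. This makes the connecting map independent of the
  lift.\<close>

lemma coset_lift_unique:
  assumes "x \<in> carrier G" "x' \<in> carrier G" "p x = p x'" "p x \<in> kernel A C a"
  shows "N #>\<^bsub>B'\<^esub> q x = N #>\<^bsub>B'\<^esub> q x'"
proof -
  interpret B': group B'
    using b.subgroup_kernel q.H.subgroup_imp_group by blast
  have "x' \<otimes> inv x \<in> kernel G A p"
    using assms by (simp add: kernel_def)
  moreover have "q (x' \<otimes> inv x) \<otimes>\<^bsub>B\<^esub> q x = q x'"
    using assms by (simp add: q.H.m_assoc)
  ultimately have "q x' \<in> N #>\<^bsub>B'\<^esub> q x"
    unfolding r_coset_def by force
  then show ?thesis
    using assms lift_kernel_iff B'.repr_independence[OF _ _ normal_imp_subgroup[OF normal_N]]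
    by simp
qed

text \<open>\<open>\<delta>\<close> is any function that can be computed from lifts along
  \<open>p\<close>. As \<open>p\<close> is surjective, this fixes \<open>\<delta>\<close> on all of
  \<open>A'\<close>, so a map defined through a choice of lifts can be inserted directly.\<close>

lemma short_exact_kernels:
  assumes ker: "\<And>x. \<lbrakk>x \<in> carrier G; p x = \<one>\<^bsub>A\<^esub>; q x = \<one>\<^bsub>B\<^esub>\<rbrakk> \<Longrightarrow> x = \<one>"
    and \<delta>: "\<And>x. \<lbrakk>x \<in> carrier G; p x \<in> kernel A C a\<rbrakk> \<Longrightarrow> \<delta> (p x) = N #>\<^bsub>B'\<^esub> q x"
  shows "short_exact K A' (B' Mod N) p \<delta>"
proof -
  interpret K: group K
    using q.subgroup_kernel p.G.subgroup_imp_group by blast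
  interpret A': group A'
    using a.subgroup_kernel p.H.subgroup_imp_group by blast
  interpret B': group B'
    using b.subgroup_kernel q.H.subgroup_imp_group by blast
  interpret N: normal N B' by (rule normal_N)
  show ?thesis
    unfolding short_exact_def
  proof (intro conjI)
    show "group_hom K A' p"
      unfolding group_hom_def group_hom_axioms_def hom_def
      using K.is_group A'.is_group by (simp add: Pi_iff kernel_def comm)
    show \<delta>_hom: "group_hom A' (B' Mod N) \<delta>"
      unfolding group_hom_def group_hom_axioms_def
    proof (intro conjI homI)
      fix y assume "y \<in> carrier A'"
      then obtain x where x: "x \<in> carrier G" "p x = y" "p x \<in> kernel A C a"
        using lift by force
      then show "\<delta> y \<in> carrier (B' Mod N)"
        using \<delta> lift_kernel_iff by (auto simp: carrier_FactGroup)
    next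
      fix y y' assume "y \<in> carrier A'" "y' \<in> carrier A'"
      then have y: "y \<in> kernel A C a" and y': "y' \<in> kernel A C a" by simp_all
      obtain x where x: "x \<in> carrier G" "p x = y" "p x \<in> kernel A C a"
        using lift[OF y] y by blast
      obtain x' where x': "x' \<in> carrier G" "p x' = y'" "p x' \<in> kernel A C a"
        using lift[OF y'] y' by blast
      \<comment> \<open>The product of the two lifts is a lift of the product, so it may be used to
        compute \<open>\<delta>\<close> there.\<close>
      have prod: "p (x \<otimes> x') \<in> kernel A C a"
        using x x' by (simp add: kernel_def)
      have "\<delta> (y \<otimes>\<^bsub>A'\<^esub> y') = \<delta> (p (x \<otimes> x'))"
        using x x' by simp
      also have "\<dots> = N #>\<^bsub>B'\<^esub> (q x \<otimes>\<^bsub>B'\<^esub> q x')"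
        using \<delta>[OF _ prod] x x' by simp
      also have "\<dots> = \<delta> y \<otimes>\<^bsub>B' Mod N\<^esub> \<delta> y'"
        using N.rcos_sum[of "q x" "q x'"] \<delta> x x' lift_kernel_iff by (auto simp: FactGroup_def)
      finally show "\<delta> (y \<otimes>\<^bsub>A'\<^esub> y') = \<delta> y \<otimes>\<^bsub>B' Mod N\<^esub> \<delta> y'" .
    qed (simp_all add: A'.is_group N.factorgroup_is_group)
    \<comment> \<open>Elements of \<open>K\<close> already have trivial image under
      \<open>q\<close>, so \<open>ker\<close> applies.\<close>
    show "kernel K A' p = {\<one>\<^bsub>K\<^esub>}"
      using ker by (auto simp: kernel_def)
    show "p ` carrier K = kernel A' (B' Mod N) \<delta>"
    proof (intro equalityI subsetI)
      fix y assume "y \<in> p ` carrier K"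
      then obtain x where x: "x \<in> carrier G" "q x = \<one>\<^bsub>B\<^esub>" "y = p x"
        by (auto simp: kernel_def)
      then have y: "p x \<in> kernel A C a"
        using comm by (simp add: kernel_def)
      have "q x = \<one>\<^bsub>B'\<^esub>" using x(2) by simp
      then have "\<delta> (p x) = N"
        unfolding \<delta>[OF x(1) y]
        by (metis B'.coset_join2[OF B'.one_closed N.subgroup_axioms N.one_closed])
      then show "y \<in> kernel A' (B' Mod N) \<delta>"
        using x y by (simp add: kernel_def)
    next
      fix y assume y: "y \<in> kernel A' (B' Mod N) \<delta>"
      then have yk: "y \<in> kernel A C a" and \<delta>y: "\<delta> y = N"
        by (simp_all add: kernel_def)
      obtain x where x: "x \<in> carrier G" "p x = y" using lift[OF yk] by blast
      have "q x \<in> carrier B'" using x yk lift_kernel_iff by simp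
      moreover have "N #>\<^bsub>B'\<^esub> q x = N" using \<delta>[OF x(1)] x yk \<delta>y by simp
      ultimately have "q x \<in> N"
        using B'.coset_join1 N.subgroup_axioms by blast
      \<comment> \<open>The lift \<open>x\<close> is corrected by \<open>n\<close>: since
        \<open>n\<close> is in ker \<open>p\<close>, the element \<open>inv n \<otimes> x\<close>
        still lifts \<open>y\<close>, and since \<open>q n = q x\<close>, it now lies in ker
        \<open>q\<close>.\<close>
      then obtain n where n: "n \<in> carrier G" "p n = \<one>\<^bsub>A\<^esub>" "q n = q x"
        by (auto simp: kernel_def)
      have "inv n \<otimes> x \<in> carrier K" and "p (inv n \<otimes> x) = y"
        using n x(1) by (simp_all add: kernel_def flip: x(2))
      then show "y \<in> p ` carrier K" by blast
    qed
    show "\<delta> ` carrier A' = carrier (B' Mod N)"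
    proof (intro equalityI subsetI)
      fix c assume "c \<in> carrier (B' Mod N)"
      then obtain y where y: "y \<in> kernel B C b" "c = N #>\<^bsub>B'\<^esub> y"
        by (auto simp: carrier_FactGroup)
      \<comment> \<open>A preimage of the coset of \<open>y\<close> is found by lifting along
        \<open>q\<close> and pushing down along \<open>p\<close>.\<close>
      then obtain x where x: "x \<in> carrier G" "q x = y"
        by (auto simp: kernel_def simp flip: q_surj)
      then have "p x \<in> kernel A C a" using y lift_kernel_iff by blast
      moreover from this have "c = \<delta> (p x)" using \<delta>[OF x(1)] x y by simp
      ultimately show "c \<in> \<delta> ` carrier A'" by simp
    qed (use group_hom.hom_closed[OF \<delta>_hom] in blast)
  qed
qed

end

section \<open>Inner automorphism groups\<close>

lemma qsym_Bij:
  assumes "quandle P" "x \<in> carrier P"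
  shows "restrict (qsym P x) (carrier P) \<in> Bij (carrier P)"
  using quandle.qsym_bij[OF assms] by (simp add: Bij_def)

lemma group_Inn: "group (Inn P)"
  by (simp add: Inn_def group.group_subgroup_generated group_BijGroup)

lemma Inn_Bij: "\<phi> \<in> carrier (Inn P) \<Longrightarrow> \<phi> \<in> Bij (carrier P)"
  using group.carrier_subgroup_generated_subset[OF group_BijGroup]
  by (fastforce simp: Inn_def BijGroup_def)

lemma Inn_closed: "\<lbrakk>\<phi> \<in> carrier (Inn P); x \<in> carrier P\<rbrakk> \<Longrightarrow> \<phi> x \<in> carrier P"
  using Inn_Bij Bij_imp_funcset by blast

lemma Inn_eqI:
  assumes "\<phi> \<in> carrier (Inn P)" "\<psi> \<in> carrier (Inn P)" "\<And>x. x \<in> carrier P \<Longrightarrow> \<phi> x = \<psi> x"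
  shows "\<phi> = \<psi>"
  using assms Inn_Bij Bij_imp_extensional extensionalityI by metis

lemma one_Inn: "\<one>\<^bsub>Inn P\<^esub> = (\<lambda>x\<in>carrier P. x)"
  by (simp add: Inn_def BijGroup_def)

lemma mult_Inn_apply:
  assumes "\<phi> \<in> carrier (Inn P)" "\<psi> \<in> carrier (Inn P)" "x \<in> carrier P"
  shows "(\<phi> \<otimes>\<^bsub>Inn P\<^esub> \<psi>) x = \<phi> (\<psi> x)"
  using assms Inn_Bij[OF assms(1)] Inn_Bij[OF assms(2)]
  by (simp add: Inn_def BijGroup_def compose_def)

lemma qsym_Inn:
  assumes "quandle P" "x \<in> carrier P"
  shows "restrict (qsym P x) (carrier P) \<in> carrier (Inn P)"
  using assms qsym_Bij[OF assms]
  by (auto simp: Inn_def carrier_subgroup_generated BijGroup_def intro!: generate.incl)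

text \<open>The induction rule of \<open>generate\<close>, restated inside \<open>Inn P\<close>. The
  inverse case ranges over arbitrary elements, so a property is shown to define a subgroup that
  contains the generators.\<close>

lemma Inn_induct [consumes 2, case_names one qsym inv mult]:
  assumes "quandle P" and "\<phi> \<in> carrier (Inn P)"
    and one: "R \<one>\<^bsub>Inn P\<^esub>"
    and qsym: "\<And>x. x \<in> carrier P \<Longrightarrow> R (restrict (qsym P x) (carrier P))"
    and inv: "\<And>\<phi>. \<lbrakk>\<phi> \<in> carrier (Inn P); R \<phi>\<rbrakk> \<Longrightarrow> R (inv\<^bsub>Inn P\<^esub> \<phi>)"
    and mult: "\<And>\<phi> \<psi>. \<lbrakk>\<phi> \<in> carrier (Inn P); \<psi> \<in> carrier (Inn P); R \<phi>; R \<psi>\<rbrakk>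
      \<Longrightarrow> R (\<phi> \<otimes>\<^bsub>Inn P\<^esub> \<psi>)"
  shows "R \<phi>"
proof -
  interpret BG: group "BijGroup (carrier P)" by (rule group_BijGroup)
  \<comment> \<open>\<open>subgroup_generated\<close> intersects the generating set with the carrier
    of the ambient group.\<close>
  let ?S = "carrier (BijGroup (carrier P)) \<inter> (\<lambda>x. restrict (qsym P x) (carrier P)) ` carrier P"
  have carrier: "carrier (Inn P) = generate (BijGroup (carrier P)) ?S"
    by (simp add: Inn_def carrier_subgroup_generated)
  have "\<phi> \<in> generate (BijGroup (carrier P)) ?S"
    using assms(2) carrier by simp
  then show ?thesis
  proof induction
    case one
    then show ?case using \<open>R \<one>\<^bsub>Inn P\<^esub>\<close> by (simp add: Inn_def)
  next
    case (incl h)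
    then show ?case using qsym by blast
  next
    case (inv h)
    then have "h \<in> carrier (Inn P)" "R h"
      using qsym carrier generate.incl by (metis, blast)
    then show ?case
      using assms(5) BG.inv_subgroup_generated by (metis Inn_def)
  next
    case (eng h k)
    then show ?case using mult carrier by (simp add: Inn_def)
  qed
qed

section \<open>Induced homomorphisms of inner automorphism groups\<close>

text \<open>On generators, the homomorphism property says that \<open>f\<close> carries the symmetry
  at \<open>x\<close> to the symmetry at \<open>f x\<close>. Identities, inverses and products of
  elements with a counterpart have one as well.\<close>

lemma Inn_induced_exists:
  assumes "quandle P" "quandle Q" "f \<in> quandle_hom P Q" "\<phi> \<in> carrier (Inn P)"
  shows "\<exists>\<psi>\<in>carrier (Inn Q). \<forall>x\<in>carrier P. f (\<phi> x) = \<psi> (f x)"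
proof -
  interpret IP: group "Inn P" by (rule group_Inn)
  interpret IQ: group "Inn Q" by (rule group_Inn)
  have f: "f x \<in> carrier Q" if "x \<in> carrier P" for x
    using assms(3) that by (auto simp: quandle_hom_def)
  show ?thesis using assms(1,4)
  proof (induction rule: Inn_induct)
    case one
    show ?case by (rule bexI[OF _ IQ.one_closed]) (simp add: one_Inn f)
  next
    case (qsym x)
    then have "f (restrict (qsym P x) (carrier P) y) = restrict (qsym Q (f x)) (carrier Q) (f y)"
      if "y \<in> carrier P" for y
      using assms(3) that f by (simp add: quandle_hom_def)
    then show ?case using qsym_Inn[OF assms(2) f[OF qsym]] by blast
  next
    case (inv \<phi>)
    then obtain \<psi> where \<psi>: "\<psi> \<in> carrier (Inn Q)" "\<forall>x\<in>carrier P. f (\<phi> x) = \<psi> (f x)" by blast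
    have "f ((inv\<^bsub>Inn P\<^esub> \<phi>) x) = (inv\<^bsub>Inn Q\<^esub> \<psi>) (f x)" if x: "x \<in> carrier P" for x
    proof -
      \<comment> \<open>Here \<open>?y\<close> is the preimage of \<open>x\<close> under
        \<open>\<phi>\<close>. Hence \<open>f x = \<psi> (f ?y)\<close>, and applying the inverse of
        \<open>\<psi>\<close> gives the claim.\<close>
      let ?y = "(inv\<^bsub>Inn P\<^esub> \<phi>) x"
      have y: "?y \<in> carrier P" by (rule Inn_closed[OF IP.inv_closed[OF inv(1)] x])
      have "\<phi> ?y = x"
        using mult_Inn_apply[of \<phi> P "inv\<^bsub>Inn P\<^esub> \<phi>" x] inv(1) x by (simp add: one_Inn)
      then have "(inv\<^bsub>Inn Q\<^esub> \<psi>) (f x) = (inv\<^bsub>Inn Q\<^esub> \<psi>) (\<psi> (f ?y))"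
        using \<psi>(2) y by fastforce
      also have "\<dots> = f ?y"
        using mult_Inn_apply[of "inv\<^bsub>Inn Q\<^esub> \<psi>" Q \<psi> "f ?y"] \<psi> f[OF y]
        by (simp add: one_Inn)
      finally show ?thesis by simp
    qed
    then show ?case using \<psi> by blast
  next
    case (mult \<phi>1 \<phi>2)
    then obtain \<psi>1 \<psi>2 where \<psi>:
      "\<psi>1 \<in> carrier (Inn Q)" "\<forall>x\<in>carrier P. f (\<phi>1 x) = \<psi>1 (f x)"
      "\<psi>2 \<in> carrier (Inn Q)" "\<forall>x\<in>carrier P. f (\<phi>2 x) = \<psi>2 (f x)" by blast
    have "\<forall>x\<in>carrier P. f ((\<phi>1 \<otimes>\<^bsub>Inn P\<^esub> \<phi>2) x) = (\<psi>1 \<otimes>\<^bsub>Inn Q\<^esub> \<psi>2) (f x)"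
      and "\<psi>1 \<otimes>\<^bsub>Inn Q\<^esub> \<psi>2 \<in> carrier (Inn Q)"
      using mult(1,2) \<psi> f by (simp_all add: mult_Inn_apply Inn_closed)
    then show ?case by blast
  qed
qed

lemma quandle_epiE:
  assumes "f \<in> quandle_epi P Q" "y \<in> carrier Q"
  obtains x where "x \<in> carrier P" "f x = y"
proof -
  have "y \<in> f ` carrier P" using assms by (simp add: quandle_epi_def)
  then show thesis using that by blast
qed

text \<open>Uniqueness behind the definite description: two candidates agree on the image of
  \<open>f\<close>, which is all of \<open>Q\<close>.\<close>

lemma Inn_map_eqI:
  assumes "f \<in> quandle_epi P Q" "\<psi> \<in> carrier (Inn Q)"
    and "\<And>x. x \<in> carrier P \<Longrightarrow> f (\<phi> x) = \<psi> (f x)"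
  shows "Inn_map P Q f \<phi> = \<psi>"
  unfolding Inn_map_def
proof (rule the_equality)
  show "\<psi> \<in> carrier (Inn Q) \<and> (\<forall>x\<in>carrier P. f (\<phi> x) = \<psi> (f x))"
    using assms by blast
next
  fix \<psi>' assume \<psi>': "\<psi>' \<in> carrier (Inn Q) \<and> (\<forall>x\<in>carrier P. f (\<phi> x) = \<psi>' (f x))"
  show "\<psi>' = \<psi>"
  proof (rule Inn_eqI)
    fix y assume "y \<in> carrier Q"
    then obtain x where "x \<in> carrier P" "f x = y"
      by (rule quandle_epiE[OF assms(1)])
    then show "\<psi>' y = \<psi> y" using \<psi>' assms(3) by metis
  qed (use \<psi>' assms in auto)
qed

lemma
  assumes "quandle P" "quandle Q" "f \<in> quandle_epi P Q" "\<phi> \<in> carrier (Inn P)"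
  shows Inn_map_closed: "Inn_map P Q f \<phi> \<in> carrier (Inn Q)"
    and Inn_map_apply: "x \<in> carrier P \<Longrightarrow> Inn_map P Q f \<phi> (f x) = f (\<phi> x)"
proof -
  have "f \<in> quandle_hom P Q" using assms(3) by (simp add: quandle_epi_def)
  then obtain \<psi> where \<psi>: "\<psi> \<in> carrier (Inn Q)" "\<forall>x\<in>carrier P. f (\<phi> x) = \<psi> (f x)"
    using Inn_induced_exists[OF assms(1,2) _ assms(4)] by blast
  then have "Inn_map P Q f \<phi> = \<psi>" using Inn_map_eqI[OF assms(3)] by blast
  with \<psi> show "Inn_map P Q f \<phi> \<in> carrier (Inn Q)"
    and "x \<in> carrier P \<Longrightarrow> Inn_map P Q f \<phi> (f x) = f (\<phi> x)" by simp_all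
qed

lemma group_hom_Inn_map:
  assumes "quandle P" "quandle Q" "f \<in> quandle_epi P Q"
  shows "group_hom (Inn P) (Inn Q) (Inn_map P Q f)"
  unfolding group_hom_def group_hom_axioms_def
proof (intro conjI homI group_Inn)
  interpret IQ: group "Inn Q" by (rule group_Inn)
  have f: "f x \<in> carrier Q" if "x \<in> carrier P" for x
    using assms(3) that by (auto simp: quandle_epi_def quandle_hom_def)
  fix \<phi> \<psi> assume "\<phi> \<in> carrier (Inn P)" "\<psi> \<in> carrier (Inn P)"
  then show "Inn_map P Q f (\<phi> \<otimes>\<^bsub>Inn P\<^esub> \<psi>) = Inn_map P Q f \<phi> \<otimes>\<^bsub>Inn Q\<^esub> Inn_map P Q f \<psi>"
    by (intro Inn_map_eqI[OF assms(3)])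
      (simp_all add: Inn_map_closed[OF assms] Inn_map_apply[OF assms] mult_Inn_apply Inn_closed f)
qed (rule Inn_map_closed[OF assms])

text \<open>The image is a subgroup, and it contains each generator: the symmetry at
  \<open>y\<close> is the image of the symmetry at any \<open>x\<close> over
  \<open>y\<close>.\<close>

lemma Inn_map_surj:
  assumes "quandle P" "quandle Q" "f \<in> quandle_epi P Q"
  shows "Inn_map P Q f ` carrier (Inn P) = carrier (Inn Q)"
proof (intro equalityI subsetI)
  interpret h: group_hom "Inn P" "Inn Q" "Inn_map P Q f"
    by (rule group_hom_Inn_map[OF assms])
  fix \<psi> assume "\<psi> \<in> carrier (Inn Q)"
  with assms(2) show "\<psi> \<in> Inn_map P Q f ` carrier (Inn P)"
  proof (induction rule: Inn_induct)
    case one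
    show ?case using imageI[OF h.G.one_closed, of "Inn_map P Q f"] by simp
  next
    case (qsym y)
    then obtain x where x: "x \<in> carrier P" "f x = y"
      by (rule quandle_epiE[OF assms(3)])
    then have "Inn_map P Q f (restrict (qsym P x) (carrier P)) = restrict (qsym Q y) (carrier Q)"
      using assms(3) qsym
      by (intro Inn_map_eqI[OF assms(3)] qsym_Inn[OF assms(2)])
        (auto simp: quandle_epi_def quandle_hom_def)
    then show ?case
      using imageI[OF qsym_Inn[OF assms(1) x(1)], of "Inn_map P Q f"] by (simp only:)
  next
    case (inv \<psi>)
    then obtain \<phi> where "\<phi> \<in> carrier (Inn P)" "\<psi> = Inn_map P Q f \<phi>" by blast
    then show ?case using imageI[OF h.G.inv_closed[of \<phi>], of "Inn_map P Q f"] by simp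
  next
    case (mult \<psi>1 \<psi>2)
    then obtain \<phi>1 \<phi>2 where "\<phi>1 \<in> carrier (Inn P)" "\<psi>1 = Inn_map P Q f \<phi>1"
      and "\<phi>2 \<in> carrier (Inn P)" "\<psi>2 = Inn_map P Q f \<phi>2" by blast
    then show ?case using imageI[OF h.G.m_closed[of \<phi>1 \<phi>2], of "Inn_map P Q f"] by simp
  qed
qed (use Inn_map_closed[OF assms] in auto)

section \<open>The exact sequence of the pullback square\<close>

text \<open>\<open>connecting_map\<close> picks a lift by \<open>SOME\<close> and \<open>Mod\<close>
  does not enforce normality. The conjuncts before \<open>short_exact\<close> therefore establish
  that the quotient makes sense and that the connecting map is well defined.\<close>

theorem proposition3p28:
  fixes P :: "('a, 'm) quandle_struct_scheme"
    and Q :: "('b, 'n) quandle_struct_scheme"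
    and Q' :: "('c, 'o) quandle_struct_scheme"
    and f :: "'a \<Rightarrow> 'b" and g :: "'c \<Rightarrow> 'b"
  assumes "quandle P" and "quandle Q" and "quandle Q'"
    and "f \<in> quandle_epi P Q" and "g \<in> quandle_epi Q' Q"
  shows "let P' = quandle_pullback P Q' f g;
             N = Inn_map P' Q' snd ` carrier (Inn_rel P' P fst);
             \<delta> = connecting_map P Q Q' f g
         in N \<lhd> Inn_rel Q' Q g \<and>
            (\<forall>\<phi>\<in>carrier (Inn_rel P Q f). \<exists>\<phi>'\<in>carrier (Inn P'). Inn_map P' P fst \<phi>' = \<phi>) \<and>
            (\<forall>\<phi>\<in>carrier (Inn_rel P Q f). \<forall>\<phi>'\<in>carrier (Inn P'). Inn_map P' P fst \<phi>' = \<phi> \<longrightarrow>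
               Inn_map P' Q' snd \<phi>' \<in> carrier (Inn_rel Q' Q g) \<and>
               \<delta> \<phi> = N #>\<^bsub>Inn_rel Q' Q g\<^esub> Inn_map P' Q' snd \<phi>') \<and>
            short_exact (Inn_rel P' Q' snd) (Inn_rel P Q f) (Inn_rel Q' Q g Mod N)
              (Inn_map P' P fst) \<delta>"
proof -
  define P' where "P' = quandle_pullback P Q' f g"
  define N where "N = Inn_map P' Q' snd ` carrier (Inn_rel P' P fst)"
  note fst_epi = quandle_pullback_projections(1)[OF assms(4,5), folded P'_def]
  note snd_epi = quandle_pullback_projections(2)[OF assms(4,5), folded P'_def]
  have P': "quandle P'"
    unfolding P'_def
    by (rule Defs.quandle_pullback[OF assms(1-3)]) (use assms(4,5) in \<open>simp_all add: quandle_epi_def\<close>)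
  note fst_map = P' assms(1) fst_epi and snd_map = P' assms(3) snd_epi
    and f_map = assms(1,2,4) and g_map = assms(3,2,5)
  have proj: "fst x \<in> carrier P" "snd x \<in> carrier Q'" "f (fst x) = g (snd x)"
    if "x \<in> carrier P'" for x
    using that by (auto simp: P'_def quandle_pullback_def)
  \<comment> \<open>Each point of \<open>Q\<close> is \<open>f (fst x) = g (snd x)\<close> for some
    \<open>x\<close> in the pullback. There the two sides are \<open>f (fst (\<phi> x))\<close> and
    \<open>g (snd (\<phi> x))\<close>, which agree because \<open>\<phi> x\<close> is again in the
    pullback.\<close>
  have comm: "Inn_map P Q f (Inn_map P' P fst \<phi>) = Inn_map Q' Q g (Inn_map P' Q' snd \<phi>)"
    if \<phi>: "\<phi> \<in> carrier (Inn P')" for \<phi>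
  proof (rule Inn_eqI)
    fix y assume "y \<in> carrier Q"
    then obtain z where z: "z \<in> carrier P" "f z = y"
      by (rule quandle_epiE[OF assms(4)])
    obtain x where "x \<in> carrier P'" "fst x = z"
      by (rule quandle_epiE[OF fst_epi z(1)])
    with z(2) have x: "x \<in> carrier P'" "y = f (fst x)" by simp_all
    have gx: "y = g (snd x)" using x proj(3) by simp
    have "Inn_map P Q f (Inn_map P' P fst \<phi>) y = f (fst (\<phi> x))"
      unfolding x(2) using Inn_map_apply[OF f_map Inn_map_closed[OF fst_map \<phi>] proj(1)[OF x(1)]]
        Inn_map_apply[OF fst_map \<phi> x(1)] by simp
    also have "\<dots> = g (snd (\<phi> x))"
      using proj Inn_closed[OF \<phi> x(1)] by simp
    also have "\<dots> = Inn_map Q' Q g (Inn_map P' Q' snd \<phi>) y"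
      unfolding gx using Inn_map_apply[OF g_map Inn_map_closed[OF snd_map \<phi>] proj(2)[OF x(1)]]
        Inn_map_apply[OF snd_map \<phi> x(1)] by simp
    finally show "Inn_map P Q f (Inn_map P' P fst \<phi>) y = Inn_map Q' Q g (Inn_map P' Q' snd \<phi>) y" .
  qed (use \<phi> in \<open>auto intro!: Inn_map_closed fst_map snd_map assms\<close>)
  have ker: "\<phi> = \<one>\<^bsub>Inn P'\<^esub>"
    if \<phi>: "\<phi> \<in> carrier (Inn P')" "Inn_map P' P fst \<phi> = \<one>\<^bsub>Inn P\<^esub>"
      "Inn_map P' Q' snd \<phi> = \<one>\<^bsub>Inn Q'\<^esub>" for \<phi>
  proof (rule Inn_eqI)
    fix x assume x: "x \<in> carrier P'"
    \<comment> \<open>Triviality of the two induced maps means that \<open>\<phi>\<close> fixes each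
      coordinate.\<close>
    have "fst (\<phi> x) = fst x" "snd (\<phi> x) = snd x"
      using Inn_map_apply[OF fst_map \<phi>(1) x] Inn_map_apply[OF snd_map \<phi>(1) x] \<phi> proj x
      by (simp_all add: one_Inn)
    then show "\<phi> x = \<one>\<^bsub>Inn P'\<^esub> x" using x by (simp add: one_Inn prod_eq_iff)
  qed (simp_all add: \<phi>(1) group.is_monoid[OF group_Inn] monoid.one_closed)
  have rel: "Inn_map P' Q' snd \<phi>' \<in> carrier (Inn_rel Q' Q g)"
    if "\<phi>' \<in> carrier (Inn P')" "Inn_map P' P fst \<phi>' \<in> carrier (Inn_rel P Q f)" for \<phi>'
    using that comm Inn_map_closed[OF snd_map] by (simp add: Inn_rel_def kernel_def)
  interpret sq: surjective_square "Inn P'" "Inn P" "Inn Q'" "Inn Q" "Inn_map P' P fst"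
    "Inn_map P' Q' snd" "Inn_map P Q f" "Inn_map Q' Q g"
    by (intro surjective_square.intro surjective_square_axioms.intro group_hom_Inn_map
        Inn_map_surj comm fst_map snd_map assms)
  have lift: "\<exists>\<phi>'\<in>carrier (Inn P'). Inn_map P' P fst \<phi>' = \<phi>"
    if "\<phi> \<in> carrier (Inn_rel P Q f)" for \<phi>
    using that sq.lift by (simp add: Inn_rel_def)
  have N_eq: "N = sq.N"
    by (simp add: N_def Inn_rel_def)
  have normal: "N \<lhd> Inn_rel Q' Q g"
    using sq.normal_N by (simp add: N_eq Inn_rel_def)
  have \<delta>: "connecting_map P Q Q' f g \<phi> = N #>\<^bsub>Inn_rel Q' Q g\<^esub> Inn_map P' Q' snd \<phi>'"
    if \<phi>: "\<phi> \<in> carrier (Inn_rel P Q f)" and \<phi>': "\<phi>' \<in> carrier (Inn P')" "Inn_map P' P fst \<phi>' = \<phi>"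
    for \<phi> \<phi>'
  proof -
    \<comment> \<open>This is the lift chosen inside \<open>connecting_map\<close>. The given
      \<open>\<phi>'\<close> shows that a lift exists, and independence of the lift then replaces
      \<open>\<psi>\<close> by \<open>\<phi>'\<close>.\<close>
    define \<psi> where "\<psi> = (SOME \<psi>. \<psi> \<in> carrier (Inn P') \<and> Inn_map P' P fst \<psi> = \<phi>)"
    have \<psi>: "\<psi> \<in> carrier (Inn P') \<and> Inn_map P' P fst \<psi> = \<phi>"
      unfolding \<psi>_def by (rule someI[of _ \<phi>']) (simp add: \<phi>')
    have "connecting_map P Q Q' f g \<phi> = N #>\<^bsub>Inn_rel Q' Q g\<^esub> Inn_map P' Q' snd \<psi>"
      by (simp add: connecting_map_def Inn_rel_image_def Let_def N_def \<psi>_def P'_def)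
    also have "\<dots> = N #>\<^bsub>Inn_rel Q' Q g\<^esub> Inn_map P' Q' snd \<phi>'"
      using sq.coset_lift_unique[of \<psi> \<phi>'] \<psi> \<phi> \<phi>' by (simp add: N_eq Inn_rel_def)
    finally show ?thesis .
  qed
  have "short_exact (Inn_rel P' Q' snd) (Inn_rel P Q f) (Inn_rel Q' Q g Mod N)
      (Inn_map P' P fst) (connecting_map P Q Q' f g)"
    \<comment> \<open>This exposes the kernels \<open>sq.K\<close>, \<open>sq.A'\<close>,
      \<open>sq.B'\<close> and the subgroup \<open>sq.N\<close> of the square.\<close>
    unfolding Inn_rel_def N_eq
    by (rule sq.short_exact_kernels[OF ker])
      (use \<delta> in \<open>simp_all add: Inn_rel_def N_eq\<close>)
  then show ?thesis
    unfolding Let_def P'_def[symmetric] N_def[symmetric]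
    by (intro conjI ballI impI normal lift rel) (simp_all add: \<delta>)
qed

end
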